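(* For every nonnegative integer $n$, let $p(n)$ denote the number of (ordinary) partitions of $n$, and let $p_{-1}(n)$ denote the number of signed partitions of $n$ in which the positive parts alternate in parity with the smallest positive part even (i.e., when the positive parts are listed in nondecreasing order, any two consecutive ones have opposite parity, and the smallest one is even), and the negative parts are distinct and each at most the number of positive parts. Then $p(n)=p_{-1}(n)$ for all $n\ge 0$.
   Context: A partition of an integer $n$ is a finite nonincreasing sequence of positive integers (its parts) summing to $n$. A signed partition of an integer $n$ is a pair $(\pi,\nu)$ of ordinary partitions with $|\pi|-|\nu|=n$, where $|\cdot|$ denotes the sum of parts; the parts of $\pi$ are the positive parts and the parts of $\nu$ are the negative parts (their sizes). The empty signed partition is a signed partition of $0$. *)

theory Defs
  imports Main
begin

definition is_partition :: "nat list \<Rightarrow> bool" where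
  "is_partition xs \<longleftrightarrow> sorted_wrt (\<ge>) xs \<and> (\<forall>x \<in> set xs. 0 < x)"

definition partitions :: "nat \<Rightarrow> nat list set" where
  "partitions n = {xs. is_partition xs \<and> sum_list xs = n}"

definition signed_partitions :: "int \<Rightarrow> (nat list \<times> nat list) set" where
  "signed_partitions n =
     {(\<pi>, \<nu>). is_partition \<pi> \<and> is_partition \<nu> \<and> int (sum_list \<pi>) - int (sum_list \<nu>) = n}"

text \<open>The argument lists the parts in nondecreasing order.
  The condition is vacuous when there are no parts.\<close>

definition alternates_from_even :: "nat list \<Rightarrow> bool" where
  "alternates_from_even xs \<longleftrightarrow>
     successively (\<lambda>x y. even x \<noteq> even y) xs \<and> (xs \<noteq> [] \<longrightarrow> even (hd xs))"

definition p :: "nat \<Rightarrow> nat" where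
  "p n = card (partitions n)"

definition p_minus_one :: "nat \<Rightarrow> nat" where
  "p_minus_one n = card {(\<pi>, \<nu>) \<in> signed_partitions (int n).
     alternates_from_even (rev \<pi>) \<and> distinct \<nu> \<and> (\<forall>x \<in> set \<nu>. x \<le> length \<pi>)}"

text \<open>Finiteness ensures that \<^const>\<open>p\<close> is a genuine count.\<close>

lemma finite_partitions: "finite (partitions n)"
proof (rule finite_subset)
  have "length xs \<le> sum_list xs" if "\<forall>x \<in> set xs. 0 < x" for xs :: "nat list"
    using that by (induction xs) auto
  then show "partitions n \<subseteq> {xs. set xs \<subseteq> {..n} \<and> length xs \<le> n}"
    by (auto simp: partitions_def is_partition_def intro: member_le_sum_list)
qed (simp add: finite_lists_length_le)

end

theory Submission
  imports Defs
begin

text \<open>Let \<open>\<pi>\<close> have \<open>m\<close> parts and regard \<open>\<nu>\<close> as a subset \<open>N\<close> of \<open>{1..m}\<close>. Subtracting the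
  conjugate of \<open>\<nu>\<close> from \<open>\<pi>\<close>, i.e. replacing the \<open>i\<close>-th largest part of \<open>\<pi>\<close> by
  \<open>\<pi>\<^sub>i - card {j \<in> N. i \<le> j}\<close>, gives a partition with exactly \<open>m\<close> parts: consecutive parts of
  \<open>\<pi>\<close> differ by at least 1, consecutive entries of the conjugate by at most 1. The parities of the
  \<open>\<pi>\<^sub>i\<close> are forced, so those of the \<open>card {j \<in> N. i \<le> j}\<close> can be read off the result; they
  determine \<open>N\<close>, and can be prescribed arbitrarily. Hence the map is a bijection onto the
  partitions with \<open>m\<close> parts. Positions are counted from 0 below.\<close>

section \<open>The conjugate of a set of negative parts\<close>

definition tail_card :: "nat set \<Rightarrow> nat \<Rightarrow> nat" where
  "tail_card N i = card {j \<in> N. i < j}"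

lemma tail_card_Suc:
  assumes "finite N"
  shows "tail_card N i = tail_card N (Suc i) + of_bool (Suc i \<in> N)"
proof -
  have "{j \<in> N. i < j} = {j \<in> N. Suc i < j} \<union> (if Suc i \<in> N then {Suc i} else {})"
    by (auto intro: Suc_lessI)
  then show ?thesis
    using assms by (simp add: tail_card_def)
qed

lemma tail_card_eq_0:
  assumes "N \<subseteq> {1..m}"
  shows "tail_card N m = 0"
proof -
  have "{j \<in> N. m < j} = {}"
    using assms by auto
  then show ?thesis
    by (simp only: tail_card_def card.empty)
qed

lemma tail_card_le:
  assumes "N \<subseteq> {1..m}"
  shows "tail_card N i \<le> m - i"
proof -
  have "{j \<in> N. i < j} \<subseteq> {i<..m}"
    using assms by auto
  then have "card {j \<in> N. i < j} \<le> card {i<..m}"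
    by (rule card_mono[rotated]) simp
  then show ?thesis
    by (simp add: tail_card_def)
qed

text \<open>Double counting of the pairs \<open>i < j\<close> with \<open>j \<in> N\<close>: since
  \<open>j\<close> is at most \<open>m\<close>, it is counted for exactly \<open>j\<close> positions
  \<open>i\<close>.\<close>

lemma sum_tail_card:
  assumes "N \<subseteq> {1..m}"
  shows "(\<Sum>i<m. tail_card N i) = \<Sum>N"
proof -
  have fin: "finite N"
    using assms finite_subset by blast
  have "(\<Sum>i<m. tail_card N i) = (\<Sum>i<m. \<Sum>j\<in>N. of_bool (i < j))"
    using fin by (simp add: tail_card_def sum.If_cases of_bool_def Int_def)
  also have "\<dots> = (\<Sum>j\<in>N. \<Sum>i<m. of_bool (i < j))"
    by (rule sum.swap)
  also have "\<dots> = \<Sum>N"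
  proof (rule sum.cong[OF refl])
    fix j assume "j \<in> N"
    then have "{..<m} \<inter> {i. i < j} = {..<j}"
      using assms by auto
    then show "(\<Sum>i<m. of_bool (i < j)) = j"
      by (simp add: of_bool_def sum.If_cases)
  qed
  finally show ?thesis .
qed

text \<open>\<open>tail_card\<close> changes parity between \<open>i\<close> and
  \<open>Suc i\<close> exactly when \<open>Suc i\<close> is in the set. At \<open>m\<close> both
  values are 0, which supplies the last parity.\<close>

lemma subset_eq_if_tail_card_parity_eq:
  assumes "N \<subseteq> {1..m}" "N' \<subseteq> {1..m}"
    and "\<And>i. i < m \<Longrightarrow> even (tail_card N i) = even (tail_card N' i)"
  shows "N = N'"
proof -
  have fin: "finite N" "finite N'"
    using assms(1,2) finite_subset by blast+
  have par: "even (tail_card N i) = even (tail_card N' i)" if "i \<le> m" for i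
    using that assms by (cases "i = m") (auto simp: tail_card_eq_0)
  have "Suc i \<in> N \<longleftrightarrow> Suc i \<in> N'" if "Suc i \<le> m" for i
    using par[of i] par[of "Suc i"] that tail_card_Suc[OF fin(1), of i] tail_card_Suc[OF fin(2), of i]
    by (auto simp: of_bool_def split: if_splits)
  then have "j \<in> N \<longleftrightarrow> j \<in> N'" if "j \<in> {1..m}" for j
    using that by (cases j) auto
  then show ?thesis
    using assms(1,2) by blast
qed

section \<open>Positive parts with alternating parities\<close>

lemma is_partition_iff_nth:
  "is_partition xs \<longleftrightarrow>
     (\<forall>i. Suc i < length xs \<longrightarrow> xs ! Suc i \<le> xs ! i) \<and> (\<forall>i<length xs. 0 < xs ! i)"
  unfolding is_partition_def
  by (subst sorted_wrt_iff_nth_Suc_transp) (auto simp: all_set_conv_all_nth intro!: transpI)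

text \<open>Position \<open>i\<close> holds the (\<open>length xs - i\<close>)-th smallest part, and
  from the smallest upwards the parities run even, odd, even, and so on.\<close>

lemma alternates_from_even_rev_iff:
  "alternates_from_even (rev xs) \<longleftrightarrow> (\<forall>i<length xs. even (xs ! i) \<longleftrightarrow> odd (length xs - i))"
proof (induction xs)
  case Nil
  then show ?case by (simp add: alternates_from_even_def)
next
  case (Cons x xs)
  have "alternates_from_even (rev (x # xs)) \<longleftrightarrow>
      alternates_from_even (rev xs) \<and> (if xs = [] then even x else even (hd xs) \<noteq> even x)"
    by (cases xs) (auto simp: alternates_from_even_def successively_append_iff last_rev hd_append)
  \<comment> \<open>For nonempty \<open>xs\<close>, position 0 of the induction hypothesis ties the
    parity of \<open>hd xs\<close> to that of \<open>length xs\<close>.\<close>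
  also have "\<dots> \<longleftrightarrow> alternates_from_even (rev xs) \<and> (even x \<longleftrightarrow> even (length xs))"
    unfolding Cons.IH by (cases xs) auto
  also have "\<dots> \<longleftrightarrow> (\<forall>i<length (x # xs). even ((x # xs) ! i) \<longleftrightarrow> odd (length (x # xs) - i))"
    unfolding Cons.IH by (auto simp: All_less_Suc2)
  finally show ?case .
qed

text \<open>The smallest part is positive and even, hence at least 2. Neighbours of opposite parity
  differ, so each step towards larger parts gains at least 1.\<close>

lemma nth_lower_bound_if_alternates_from_even:
  assumes "is_partition xs" "alternates_from_even (rev xs)" "i < length xs"
  shows "length xs - i < xs ! i"
  using assms(3)
proof (induction "length xs - i" arbitrary: i)
  case 0
  then show ?case by simp
next
  case (Suc k)
  have par: "even (xs ! i') \<longleftrightarrow> odd (length xs - i')" if "i' < length xs" for i'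
    using assms(2) that by (simp add: alternates_from_even_rev_iff)
  show ?case
  proof (cases "Suc i < length xs")
    case True
    then have "length xs - Suc i < xs ! Suc i"
      using Suc.hyps by simp
    moreover have "xs ! Suc i \<le> xs ! i"
      using assms(1) True by (simp add: is_partition_iff_nth)
    moreover have "xs ! Suc i \<noteq> xs ! i"
      using par[of i] par[of "Suc i"] True
      by (metis Suc_diff_Suc Suc_lessD even_Suc)
    ultimately show ?thesis by linarith
  next
    case False
    then have last: "length xs - i = 1"
      using Suc.prems by simp
    have "even (xs ! i)" "0 < xs ! i"
      using par[OF Suc.prems] last Suc.prems assms(1) by (auto simp: is_partition_iff_nth)
    then show ?thesis
      unfolding last by presburger
  qed
qed

section \<open>Subtracting the conjugate, and its inverse\<close>

definition subtract_conjugate :: "nat list \<Rightarrow> nat set \<Rightarrow> nat list" where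
  "subtract_conjugate xs N = map (\<lambda>i. xs ! i - tail_card N i) [0..<length xs]"

lemma length_subtract_conjugate [simp]: "length (subtract_conjugate xs N) = length xs"
  by (simp add: subtract_conjugate_def)

lemma nth_subtract_conjugate [simp]:
  "i < length xs \<Longrightarrow> subtract_conjugate xs N ! i = xs ! i - tail_card N i"
  by (simp add: subtract_conjugate_def)

context
  fixes xs :: "nat list" and N :: "nat set"
  assumes part: "is_partition xs" and alt: "alternates_from_even (rev xs)"
    and N: "N \<subseteq> {1..length xs}"
begin

text \<open>This makes the truncated subtraction exact and keeps the resulting entries
  positive.\<close>

lemma tail_card_less_nth: "i < length xs \<Longrightarrow> tail_card N i < xs ! i"
  using nth_lower_bound_if_alternates_from_even[OF part alt] tail_card_le[OF N]
  by (meson order_le_less_trans)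

lemma is_partition_subtract_conjugate: "is_partition (subtract_conjugate xs N)"
proof -
  have fin: "finite N"
    using N finite_subset by blast
  have "xs ! Suc i - tail_card N (Suc i) \<le> xs ! i - tail_card N i" if i: "Suc i < length xs" for i
  proof -
    have "xs ! Suc i \<le> xs ! i"
      using part i by (simp add: is_partition_iff_nth)
    moreover have "xs ! Suc i \<noteq> xs ! i"
      using alt i unfolding alternates_from_even_rev_iff
      by (metis Suc_diff_Suc Suc_lessD even_Suc)
    ultimately show ?thesis
      using tail_card_Suc[OF fin, of i] by (auto simp: of_bool_def)
  qed
  then show ?thesis
    by (auto simp: is_partition_iff_nth tail_card_less_nth)
qed

lemma sum_list_subtract_conjugate: "sum_list (subtract_conjugate xs N) + \<Sum>N = sum_list xs"
proof -
  have "sum_list (subtract_conjugate xs N) + \<Sum>N =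
      (\<Sum>i<length xs. (xs ! i - tail_card N i) + tail_card N i)"
    unfolding sum.distrib sum_tail_card[OF N]
    by (simp add: sum_list_sum_nth atLeast0LessThan)
  also have "\<dots> = (\<Sum>i<length xs. xs ! i)"
    by (intro sum.cong) (auto dest: tail_card_less_nth)
  finally show ?thesis
    by (simp add: sum_list_sum_nth atLeast0LessThan)
qed

end

text \<open>Equal images have equal length, so the forced parities of \<open>xs\<close> and
  \<open>ys\<close> agree. Hence the parities of the two conjugates agree, which gives
  \<open>N = M\<close>, and adding the conjugate back recovers the parts.\<close>

lemma subtract_conjugate_inject:
  assumes "is_partition xs" "alternates_from_even (rev xs)" "N \<subseteq> {1..length xs}"
    and "is_partition ys" "alternates_from_even (rev ys)" "M \<subseteq> {1..length ys}"
    and eq: "subtract_conjugate xs N = subtract_conjugate ys M"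
  shows "xs = ys \<and> N = M"
proof -
  have len: "length xs = length ys"
    using eq by (metis length_subtract_conjugate)
  have nth: "xs ! i - tail_card N i = ys ! i - tail_card M i" if "i < length xs" for i
    using eq that len by (metis nth_subtract_conjugate)
  note less = tail_card_less_nth[OF assms(1-3)] tail_card_less_nth[OF assms(4-6)]
  have "N = M"
  proof (rule subset_eq_if_tail_card_parity_eq)
    fix i assume i: "i < length xs"
    have "even (xs ! i) \<longleftrightarrow> even (ys ! i)"
      using assms(2,5) i len by (simp add: alternates_from_even_rev_iff)
    moreover have "xs ! i + tail_card M i = ys ! i + tail_card N i"
      using nth[OF i] less(1)[of i] less(2)[of i] i len by simp
    ultimately show "even (tail_card N i) = even (tail_card M i)"
      by (metis even_add)
  qed (use assms(3,6) len in auto)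
  moreover have "xs ! i = ys ! i" if i: "i < length xs" for i
    using nth[OF i] less(1)[of i] less(2)[of i] i len \<open>N = M\<close> by simp
  ultimately show ?thesis
    using len by (simp add: nth_equalityI)
qed

lemma subtract_conjugate_surject:
  assumes "is_partition ys"
  obtains xs N where "is_partition xs" "alternates_from_even (rev xs)"
    "N \<subseteq> {1..length xs}" "subtract_conjugate xs N = ys"
proof -
  let ?m = "length ys"
  \<comment> \<open>An odd part appended to \<open>ys\<close> makes the parity rule uniform, including the last position.\<close>
  define e where "e = (\<lambda>i. if i < ?m then ys ! i else 1)"
  \<comment> \<open>The required parity flips at every step, so the conjugate has to drop by 1
    exactly where \<open>e\<close> keeps its parity.\<close>
  define N where "N = {j \<in> {1..?m}. even (e (j - 1)) \<longleftrightarrow> even (e j)}"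
  define xs where "xs = map (\<lambda>i. ys ! i + tail_card N i) [0..<?m]"
  have N: "N \<subseteq> {1..?m}" and fin: "finite N"
    by (auto simp: N_def)
  have len: "length xs = ?m" and nth: "\<And>i. i < ?m \<Longrightarrow> xs ! i = ys ! i + tail_card N i"
    by (auto simp: xs_def)
  \<comment> \<open>Downward induction from \<open>?m\<close>, where \<open>e\<close> is 1 and
    \<open>tail_card\<close> is 0.\<close>
  have par: "even (e i + tail_card N i) \<longleftrightarrow> odd (?m - i)" if "i \<le> ?m" for i
    using that
  proof (induction rule: inc_induct)
    case base
    then show ?case by (simp add: e_def tail_card_eq_0[OF N])
  next
    case (step i)
    have "Suc i \<in> N \<longleftrightarrow> (even (e i) \<longleftrightarrow> even (e (Suc i)))"
      using step.hyps by (simp add: N_def)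
    moreover have "?m - i = Suc (?m - Suc i)"
      using step.hyps by simp
    ultimately show ?case
      using step.IH tail_card_Suc[OF fin, of i] by auto
  qed
  have "alternates_from_even (rev xs)"
    unfolding alternates_from_even_rev_iff len
  proof (intro allI impI)
    fix i assume i: "i < ?m"
    then have "xs ! i = e i + tail_card N i"
      by (simp add: nth e_def)
    then show "even (xs ! i) \<longleftrightarrow> odd (?m - i)"
      using par[of i] i by simp
  qed
  moreover have "is_partition xs"
    unfolding is_partition_iff_nth len
  proof (intro conjI allI impI)
    show "xs ! Suc i \<le> xs ! i" if "Suc i < ?m" for i
      using assms that tail_card_Suc[OF fin, of i] by (simp add: is_partition_iff_nth nth add_mono)
    show "0 < xs ! i" if "i < ?m" for i
      using assms that by (simp add: is_partition_iff_nth nth)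
  qed
  moreover have "subtract_conjugate xs N = ys"
    by (rule nth_equalityI) (auto simp: len nth)
  ultimately show thesis
    using that N len by metis
qed

section \<open>Distinct negative parts as sets, and the final count\<close>

lemma distinct_partition_eq_if_set_eq:
  assumes "is_partition xs" "distinct xs" "is_partition ys" "distinct ys" "set xs = set ys"
  shows "xs = ys"
proof -
  have "sorted (rev xs)" "sorted (rev ys)"
    using assms(1,3) by (simp_all add: is_partition_def sorted_wrt_rev)
  then have "rev xs = rev ys"
    using assms by (intro sorted_distinct_set_unique) auto
  then show ?thesis by simp
qed

lemma distinct_partition_of_set:
  assumes "N \<subseteq> {1..m}"
  obtains xs where "is_partition xs" "distinct xs" "set xs = N"
proof -
  have "finite N"
    using assms finite_subset by blast
  moreover from this have "is_partition (rev (sorted_list_of_set N))"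
    using assms by (auto simp: is_partition_def sorted_wrt_rev)
  ultimately show thesis
    using that[of "rev (sorted_list_of_set N)"] by simp
qed

theorem theorem2p2:
  fixes n :: nat
  shows "p n = p_minus_one n"
proof -
  let ?S = "{(\<pi>, \<nu>) \<in> signed_partitions (int n).
     alternates_from_even (rev \<pi>) \<and> distinct \<nu> \<and> (\<forall>x \<in> set \<nu>. x \<le> length \<pi>)}"
  let ?f = "\<lambda>(\<pi>, \<nu>). subtract_conjugate \<pi> (set \<nu>)"
  \<comment> \<open>The condition on the signed sum becomes a condition on the image. Positivity of
    the parts of \<open>\<nu>\<close> gives the lower bound 1 in
    \<open>{1..length \<pi>}\<close>.\<close>
  have S_iff: "(\<pi>, \<nu>) \<in> ?S \<longleftrightarrow> is_partition \<pi> \<and> alternates_from_even (rev \<pi>) \<and>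
      is_partition \<nu> \<and> distinct \<nu> \<and> set \<nu> \<subseteq> {1..length \<pi>} \<and>
      subtract_conjugate \<pi> (set \<nu>) \<in> partitions n" for \<pi> \<nu>
  proof -
    have "\<Sum>(set \<nu>) = sum_list \<nu>" if "distinct \<nu>"
      using that by (simp add: distinct_sum_list_conv_Sum)
    moreover have "set \<nu> \<subseteq> {1..length \<pi>} \<longleftrightarrow> (\<forall>x \<in> set \<nu>. x \<le> length \<pi>)" if "is_partition \<nu>"
      using that by (auto simp: is_partition_def Suc_le_eq)
    ultimately show ?thesis
      using is_partition_subtract_conjugate[of \<pi> "set \<nu>"] sum_list_subtract_conjugate[of \<pi> "set \<nu>"]
      unfolding signed_partitions_def partitions_def by auto
  qed
  have "inj_on ?f ?S"
  proof (rule inj_onI, clarify)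
    fix \<pi> \<nu> \<pi>' \<nu>'
    assume "(\<pi>, \<nu>) \<in> signed_partitions (int n)" "alternates_from_even (rev \<pi>)" "distinct \<nu>"
      "\<forall>x \<in> set \<nu>. x \<le> length \<pi>"
      and "(\<pi>', \<nu>') \<in> signed_partitions (int n)" "alternates_from_even (rev \<pi>')" "distinct \<nu>'"
      "\<forall>x \<in> set \<nu>'. x \<le> length \<pi>'"
      and eq: "subtract_conjugate \<pi> (set \<nu>) = subtract_conjugate \<pi>' (set \<nu>')"
    then have "(\<pi>, \<nu>) \<in> ?S" "(\<pi>', \<nu>') \<in> ?S"
      by auto
    then show "\<pi> = \<pi>' \<and> \<nu> = \<nu>'"
      unfolding S_iff
      using subtract_conjugate_inject[OF _ _ _ _ _ _ eq] distinct_partition_eq_if_set_eq by blast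
  qed
  moreover have "?f ` ?S = partitions n"
  proof (intro equalityI subsetI)
    fix ys assume "ys \<in> ?f ` ?S"
    then obtain \<pi> \<nu> where "ys = subtract_conjugate \<pi> (set \<nu>)" "(\<pi>, \<nu>) \<in> ?S"
      by (auto simp del: mem_Collect_eq)
    then show "ys \<in> partitions n"
      unfolding S_iff by simp
  next
    fix ys assume ys: "ys \<in> partitions n"
    then obtain \<pi> N where \<pi>: "is_partition \<pi>" "alternates_from_even (rev \<pi>)"
      "N \<subseteq> {1..length \<pi>}" "subtract_conjugate \<pi> N = ys"
      using subtract_conjugate_surject unfolding partitions_def by blast
    obtain \<nu> where "is_partition \<nu>" "distinct \<nu>" "set \<nu> = N"
      using distinct_partition_of_set[OF \<pi>(3)] .
    then have "(\<pi>, \<nu>) \<in> ?S"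
      unfolding S_iff using \<pi> ys by simp
    moreover have "ys = ?f (\<pi>, \<nu>)"
      using \<pi>(4) \<open>set \<nu> = N\<close> by simp
    ultimately show "ys \<in> ?f ` ?S"
      by (rule rev_image_eqI)
  qed
  ultimately have "bij_betw ?f ?S (partitions n)"
    by (simp add: bij_betw_def)
  then show ?thesis
    unfolding p_def p_minus_one_def by (rule bij_betw_same_card[symmetric])
qed

end
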